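(* Let $D_0>0$ and $R>0$ be constants such that the coefficients of the Maclaurin series $\mathbf f(t,\mathbf x)=\sum_{\alpha\in\mathbb Z_+^d\setminus\{0\}}\mathbf f_\alpha(t)\,\mathbf x_\alpha$, $\mathbf f_\alpha(t)=[f_{1,\alpha}(t),\dots,f_{d,\alpha}(t)]^T$, satisfy $$\sup_{t\ge t_0}\sum_{j=1}^d\sum_{\alpha\in\mathbb Z_k^d}|f_{j,\alpha}(t)|\le D_0R^{-k}\quad\text{for all }k\ge 1 .$$ Let $\mathbf x(t)$ be the solution of $\dot{\mathbf x}(t)=\mathbf f(t,\mathbf x(t))$, $t\ge t_0$, with $\mathbf x(t_0)=\mathbf x_0$, where $$0<\|\mathbf x_0\|_\infty<R/e,$$ and for $N\ge1$ let $\mathbf y_{1,N}(t)$ be the first block of the solution of the order-$N$ finite-section approximation of the Carleman linearization (defined in the context). Set $$T^*=\frac{(e-1)R}{(2e-1)D_0}\ln\left(\frac{R}{e\|\mathbf x_0\|_\infty}\right),\qquad M_0=\|\mathbf x_0\|_\infty^{(e-1)/(2e-1)}(R/e)^{e/(2e-1)}\ (<R/e).$$ Then $$\|\mathbf y_{1,N}(t)-\mathbf x(t)\|_\infty\le\frac{RM_0}{\sqrt{2\pi}(R-M_0)}\,N^{-3/2}\,e^{D_0(t-t_0)N/R}\left(\frac{\|\mathbf x_0\|_\infty e}{R}\right)^{(e-1)N/(2e-1)}$$ for all $t_0\le t\le t_0+T^*$ and all $N\ge1$.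
   Context: Notation: $\mathbb Z_+^d$ is the set of $d$-dimensional vectors of non-negative integers; $|\alpha|=\alpha_1+\dots+\alpha_d$; $\mathbb Z_k^d=\{\alpha\in\mathbb Z_+^d: |\alpha|=k\}$; $\mathbf x_\alpha=x_1^{\alpha_1}\cdots x_d^{\alpha_d}$; $\mathbf e_1,\dots,\mathbf e_d$ is the standard basis of $\mathbb R^d$; $\|\mathbf x\|_\infty=\max_j|x_j|$; $e$ is Euler's number. The system is $\dot{\mathbf x}(t)=\mathbf f(t,\mathbf x(t))$, $t\ge t_0$, $\mathbf x(t)\in\mathbb R^d$, where $\mathbf f(t,\cdot)$ is analytic near $0$, $\mathbf f(t,0)=0$, and $\mathbf f$ is given by its Maclaurin series (under the decay hypothesis the series converges absolutely for $\|\mathbf x\|_\infty<R$ and the expansion is understood to hold there). Carleman blocks: put $f_{j,\alpha}(t)=0$ whenever $\alpha\notin\mathbb Z_+^d\setminus\{0\}$, and for $k,l\ge1$ let $$\mathbf A_{k,l}(t)=\Big[\sum_{j=1}^d\alpha_jf_{j,\beta-\alpha+\mathbf e_j}(t)\Big]_{\alpha\in\mathbb Z_k^d,\ \beta\in\mathbb Z_l^d}.$$ Finite-section approximation of order $N$: the finite linear system $$\dot{\mathbf y}_{k,N}(t)=\sum_{l=k}^N\mathbf A_{k,l}(t)\,\mathbf y_{l,N}(t),\qquad \mathbf y_{k,N}(t_0)=[(\mathbf x_0)_\alpha]_{\alpha\in\mathbb Z_k^d},\qquad 1\le k\le N,$$ for $t\ge t_0$, with $\mathbf y_{k,N}(t)$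 indexed by $\mathbb Z_k^d$. The first block $\mathbf y_{1,N}(t)$ is identified with a vector in $\mathbb R^d$ via $\mathbb Z_1^d=\{\mathbf e_1,\dots,\mathbf e_d\}$. *)

theory Defs
  imports "HOL-Analysis.Analysis"
begin

definition mi_degree :: "nat ^ 'd \<Rightarrow> nat" where
  "mi_degree \<alpha> = (\<Sum>i\<in>UNIV. \<alpha> $ i)"

definition mi_of_degree :: "nat \<Rightarrow> (nat ^ 'd) set" where
  "mi_of_degree k = {\<alpha>. mi_degree \<alpha> = k}"

definition monomial :: "real ^ 'd \<Rightarrow> nat ^ 'd \<Rightarrow> real" where
  "monomial x \<alpha> = (\<Prod>i\<in>UNIV. (x $ i) ^ (\<alpha> $ i))"

lemma finite_mi_of_degree: "finite (mi_of_degree k :: (nat ^ 'd) set)"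
proof (rule finite_imageD)
  have "vec_nth ` (mi_of_degree k :: (nat ^ 'd) set) \<subseteq> PiE UNIV (\<lambda>_. {..k})"
    by (auto simp: mi_of_degree_def mi_degree_def intro: member_le_sum)
  then show "finite (vec_nth ` (mi_of_degree k :: (nat ^ 'd) set))"
    by (rule finite_subset) (intro finite_PiE finite finite_atMost)
  show "inj_on vec_nth (mi_of_degree k :: (nat ^ 'd) set)"
    by (simp add: inj_on_def vec_nth_inject)
qed

text \<open>
  A family \<open>c :: 'd \<Rightarrow> nat ^ 'd \<Rightarrow> real \<Rightarrow> real\<close> holds the Maclaurin coefficients
  \<open>f\<^sub>j\<^sub>,\<^sub>\<alpha>(t) = c j \<alpha> t\<close>. Since \<open>\<beta> - \<alpha> + e\<^sub>j\<close> may have negative entries, it is formed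
  over the integers, and the coefficients are extended by zero; the value of \<open>c\<close> at the
  multi-index 0 is never used.
\<close>

definition coeff_ext ::
  "('d \<Rightarrow> nat ^ 'd \<Rightarrow> real \<Rightarrow> real) \<Rightarrow> 'd \<Rightarrow> int ^ 'd \<Rightarrow> real \<Rightarrow> real" where
  "coeff_ext c j \<gamma> t =
     (if (\<forall>i. 0 \<le> \<gamma> $ i) \<and> \<gamma> \<noteq> 0 then c j (\<chi> i. nat (\<gamma> $ i)) t else 0)"

definition mi_int :: "nat ^ 'd \<Rightarrow> int ^ 'd" where
  "mi_int \<alpha> = (\<chi> i. int (\<alpha> $ i))"

text \<open>
  The \<open>(\<alpha>, \<beta>)\<close> entry of the block \<open>A\<^sub>k\<^sub>,\<^sub>l(t)\<close>. The formula for an entry does not involve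
  \<open>k\<close> and \<open>l\<close>: these only fix the index ranges \<open>\<alpha> \<in> mi_of_degree k\<close> and
  \<open>\<beta> \<in> mi_of_degree l\<close>.
\<close>

definition carleman_entry ::
  "('d \<Rightarrow> nat ^ 'd \<Rightarrow> real \<Rightarrow> real) \<Rightarrow> real \<Rightarrow> nat ^ 'd \<Rightarrow> nat ^ 'd \<Rightarrow> real" where
  "carleman_entry c t \<alpha> \<beta> =
     (\<Sum>j\<in>UNIV. real (\<alpha> $ j) * coeff_ext c j (mi_int \<beta> - mi_int \<alpha> + axis j 1) t)"

text \<open>
  \<open>y k t \<alpha>\<close> is the \<open>\<alpha>\<close> component of \<open>y\<^sub>k\<^sub>,\<^sub>N(t)\<close>; only \<open>1 \<le> k \<le> N\<close> and
  \<open>\<alpha> \<in> mi_of_degree k\<close> are meaningful. Derivatives are relative to the time interval \<open>I\<close>,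
  hence one-sided at its end points.
\<close>

definition finite_section_solution ::
  "('d \<Rightarrow> nat ^ 'd \<Rightarrow> real \<Rightarrow> real) \<Rightarrow> real \<Rightarrow> real ^ 'd \<Rightarrow> real set \<Rightarrow> nat \<Rightarrow>
   (nat \<Rightarrow> real \<Rightarrow> nat ^ 'd \<Rightarrow> real) \<Rightarrow> bool" where
  "finite_section_solution c t0 x0 I N y \<longleftrightarrow>
     (\<forall>k\<in>{1..N}. \<forall>\<alpha>\<in>mi_of_degree k.
        y k t0 \<alpha> = monomial x0 \<alpha> \<and>
        (\<forall>t\<in>I. ((\<lambda>s. y k s \<alpha>) has_real_derivative
           (\<Sum>l=k..N. \<Sum>\<beta>\<in>mi_of_degree l. carleman_entry c t \<alpha> \<beta> * y l t \<beta>))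
           (at t within I)))"

definition first_block :: "(nat \<Rightarrow> real \<Rightarrow> nat ^ 'd \<Rightarrow> real) \<Rightarrow> real \<Rightarrow> real ^ 'd" where
  "first_block y t = (\<chi> j. y 1 t (axis j 1))"

definition ode_solution ::
  "(real \<Rightarrow> real ^ 'd \<Rightarrow> real ^ 'd) \<Rightarrow> real \<Rightarrow> real ^ 'd \<Rightarrow> real set \<Rightarrow>
   (real \<Rightarrow> real ^ 'd) \<Rightarrow> bool" where
  "ode_solution f t0 x0 I x \<longleftrightarrow>
     x t0 = x0 \<and> (\<forall>t\<in>I. (x has_vector_derivative f t (x t)) (at t within I))"

end

theory Submission imports Defs begin

text \<open>
  Write \<open>a = D0 / R\<close> and \<open>q = M0 / R\<close>. The monomials \<open>x\<^sub>\<alpha>\<close> of the true solution satisfy the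
  infinite Carleman system, so the errors \<open>u\<^sub>\<alpha> = y\<^sub>\<alpha> - x\<^sub>\<alpha>\<close> start at 0 and satisfy the truncated
  system with a forcing term, namely the part of the infinite system of degree above \<open>N\<close>.
  Three estimates turn this into a scalar problem.

  First, \<open>\<parallel>x\<parallel>' \<le> D0 \<parallel>x\<parallel> / (R - \<parallel>x\<parallel>)\<close>, and while \<open>\<parallel>x\<parallel> < R / e\<close> the right-hand side is at most
  \<open>e D0 \<parallel>x\<parallel> / ((e - 1) R)\<close>. The time \<open>T\<close> is chosen so that the resulting exponential bound reaches
  exactly \<open>M0 < R / e\<close> at the end of the interval; hence \<open>\<parallel>x\<parallel> \<le> M0\<close> throughout
  (\<open>solution_growth\<close>).
  Second, the block \<open>A\<^sub>k\<^sub>,\<^sub>l\<close> has absolute row sums at most \<open>k D0 R\<^bsup>k-l-1\<^esup>\<close>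
  (\<open>sum_abs_carleman_row_le\<close>). Third, by the decay of the coefficients the forcing term at degree
  \<open>k\<close> is at most \<open>a k R\<^bsup>k\<^esup> q\<^bsup>N+1\<^esup> / (1 - q)\<close> (\<open>carleman_truncation_residual\<close>).

  So \<open>R\<^bsup>-k\<^esup> \<bar>u\<^sub>\<alpha>\<bar>\<close>, for \<open>\<alpha>\<close> of degree \<open>k\<close>, is dominated by \<open>q\<^bsup>N+1\<^esup> / (1 - q) w\<^sub>k\<close> for any
  \<open>w\<close> with \<open>w\<^sub>k' = a k (\<Sum>l=k..N. w\<^sub>l) + a k\<close> and \<open>w\<^sub>k \<ge> 0\<close> at the initial time. The tail sums
  \<open>S\<^sub>k = 1 + (\<Sum>l=k..N. w\<^sub>l)\<close> turn this into \<open>(S\<^sub>k - S\<^sub>k\<^sub>+\<^sub>1)' = a k S\<^sub>k\<close>, which is solved by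
  \<open>S\<^sub>k = N\<^bsup>N-k\<^esup> / (N-k)! e\<^bsup>aN(t - t0)\<^esup>\<close> for \<open>k \<le> N\<close> and \<open>S\<^sub>N\<^sub>+\<^sub>1 = 1\<close>
  (\<open>carleman_error_bound\<close>). In particular
  \<open>w\<^sub>1 \<le> N\<^bsup>N-1\<^esup> / N! e\<^bsup>aN(t - t0)\<^esup>\<close>, and Stirling's lower bound for \<open>N!\<close> gives the factor
  \<open>e\<^bsup>N\<^esup> N\<^bsup>-3/2\<^esup> / sqrt (2\<pi>)\<close>. Finally \<open>e q\<close> is the power of \<open>\<parallel>x0\<parallel> e / R\<close> whose \<open>N\<close>-th power
  appears in the claim.

  The coefficients may depend on time in an arbitrary, even non-measurable, way. Both
  domination arguments therefore avoid integration: they compare derivatives at the first time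
  at which a barrier is touched (\<open>barrier_bound\<close>).
\<close>

section \<open>Stirling's lower bound for the factorial\<close>

lemma wallis_product_eq_fact:
  "(\<Prod>k=1..n. (4 * real k ^ 2) / (4 * real k ^ 2 - 1)) =
     (2 ^ n * fact n) ^ 4 / ((fact (2 * n)) ^ 2 * (2 * real n + 1))"
proof (induction n)
  case 0
  then show ?case by simp
next
  case (Suc n)
  have nz: "(fact (2 * n) :: real) \<noteq> 0" "2 * real n + 1 \<noteq> 0" "real n + 1 \<noteq> 0" "2 * real n + 3 \<noteq> 0"
    by auto
  have den: "4 * real (Suc n) ^ 2 - 1 = (2 * real n + 1) * (2 * real n + 3)"
    by (simp add: power2_eq_square algebra_simps)
  have split: "(\<Prod>k=1..Suc n. (4 * real k ^ 2) / (4 * real k ^ 2 - 1)) =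
      (2 ^ n * fact n) ^ 4 / ((fact (2 * n)) ^ 2 * (2 * real n + 1)) *
      (4 * real (Suc n) ^ 2 / (4 * real (Suc n) ^ 2 - 1))"
    using Suc.IH by simp
  have reduce: "A ^ 4 / (B ^ 2 * p) * (4 * m ^ 2 / (p * q)) =
      (2 * m * A) ^ 4 / ((2 * m * p * B) ^ 2 * q)"
    if "B \<noteq> 0" "p \<noteq> 0" "q \<noteq> 0" "m \<noteq> 0" for A B p q m :: real
    using that by (simp add: divide_simps) (simp add: power2_eq_square power4_eq_xxxx algebra_simps)
  have A: "2 ^ Suc n * fact (Suc n) = 2 * (real n + 1) * (2 ^ n * fact n :: real)"
    by (simp add: algebra_simps)
  have B: "fact (2 * Suc n) = 2 * (real n + 1) * (2 * real n + 1) * (fact (2 * n) :: real)"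
    by (simp add: algebra_simps)
  have q: "2 * real (Suc n) + 1 = 2 * real n + 3" and m: "real (Suc n) = real n + 1"
    by simp_all
  show ?case
    unfolding split den A B q
    unfolding m
    by (rule reduce) (use nz in auto)
qed

text \<open>
  The logarithm \<open>L n\<close> of \<open>n! / (sqrt n (n/e)\<^bsup>n\<^esup>)\<close> is decreasing and bounded below; hence it lies
  above its limit. Wallis' product evaluates \<open>2 L n - L (2n)\<close> in the limit and so identifies the
  limit as \<open>ln (2\<pi>) / 2\<close>.
\<close>
lemma stirling_lower_bound:
  assumes "n \<ge> 1"
  shows "sqrt (2 * pi * real n) * (real n / exp 1) ^ n \<le> fact n"
proof -
  define L :: "nat \<Rightarrow> real" where "L n = ln (fact n) - (real n + 1/2) * ln (real n) + real n" for n
  have step: "L n - L (Suc n) = (real n + 1/2) * (ln (real n + 1) - ln (real n)) - 1" if "n \<ge> 1" for n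
  proof -
    have "ln (fact (Suc n) :: real) = ln (real n + 1) + ln (fact n)"
      unfolding fact_Suc by (subst ln_mult) (auto simp: add_ac)
    then show ?thesis by (simp add: L_def algebra_simps)
  qed
  have dec: "L (Suc n) \<le> L n" if "n \<ge> 1" for n
  proof -
    have "2 / (2 * real n + 1) \<le> ln (real n + 1) - ln (real n)"
      using ln_inverse_approx_ge[of "real n" "real n + 1"] that by (simp add: add_ac)
    then have "1 \<le> (real n + 1/2) * (ln (real n + 1) - ln (real n))"
      by (simp add: field_simps)
    then show ?thesis using step[OF that] by simp
  qed
  \<comment> \<open>The trapezoidal bound for \<open>ln (n+1) - ln n\<close> makes the steps of \<open>L\<close> telescope against
      \<open>1 / (4n)\<close>. Only boundedness of \<open>L\<close> is extracted from this.\<close>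
  have inc: "L n - 1 / (4 * real n) \<le> L (Suc n) - 1 / (4 * real (Suc n))" if "n \<ge> 1" for n
  proof -
    have "ln (real n + 1) - ln (real n) \<le> (1 / real n + 1 / (real n + 1)) / 2"
      using ln_inverse_approx_le[of "real n" 1] that by (simp add: inverse_eq_divide)
    then have "(real n + 1/2) * (ln (real n + 1) - ln (real n)) \<le>
        (real n + 1/2) * ((1 / real n + 1 / (real n + 1)) / 2)"
      by (intro mult_left_mono) auto
    also have "\<dots> = 1 + 1 / (4 * real n) - 1 / (4 * real (Suc n))"
      using that by (simp add: divide_simps) (simp add: algebra_simps)
    finally show ?thesis using step[OF that] by simp
  qed
  have anti: "L (Suc m) \<le> L (Suc n)" if "n \<le> m" for m n
    using that by (induction rule: dec_induct) (use dec in \<open>auto intro: order_trans\<close>)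
  have below: "L (Suc n) \<ge> 3/4" for n
  proof -
    have "L 1 - 1 / 4 \<le> L (Suc n) - 1 / (4 * real (Suc n))"
    proof (induction n)
      case (Suc n)
      then show ?case using inc[of "Suc n"] by linarith
    qed simp
    moreover have "L 1 = 1" by (simp add: L_def)
    moreover have "1 / (4 * real (Suc n)) \<ge> 0" by simp
    ultimately show ?thesis by linarith
  qed
  have "convergent (\<lambda>n. L (Suc n))"
  proof (rule Bseq_monoseq_convergent)
    show "Bseq (\<lambda>n. L (Suc n))"
    proof (rule BseqI')
      fix n
      show "norm (L (Suc n)) \<le> L (Suc 0)" using below[of n] anti[of 0 n] by simp
    qed
    show "monoseq (\<lambda>n. L (Suc n))"
      by (simp add: monoseq_def anti)
  qed
  then obtain l where "(\<lambda>n. L (Suc n)) \<longlonglongrightarrow> l" by (auto simp: convergent_def)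
  then have lim: "L \<longlonglongrightarrow> l" by (simp only: filterlim_sequentially_Suc)
  have "(\<lambda>n. L (2 * n)) \<longlonglongrightarrow> l"
    using LIMSEQ_subseq_LIMSEQ[OF lim, of "\<lambda>n. 2 * n"] by (simp add: strict_mono_def o_def)
  with lim have "(\<lambda>n. exp (2 * (2 * L n - L (2 * n)))) \<longlonglongrightarrow> exp (2 * (2 * l - l))"
    by (intro tendsto_intros)
  moreover have "(\<lambda>n. exp (2 * (2 * L n - L (2 * n)))) \<longlonglongrightarrow> 2 * pi"
  proof (rule Lim_transform_eventually)
    have "(\<lambda>n. 4 + 2 * (1 / real n)) \<longlonglongrightarrow> 4 + 2 * 0"
      by (intro tendsto_intros lim_1_over_n)
    from tendsto_mult[OF wallis this]
    show "(\<lambda>n. (\<Prod>k=1..n. (4 * real k ^ 2) / (4 * real k ^ 2 - 1)) * (4 + 2 * (1 / real n))) \<longlonglongrightarrow> 2 * pi"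
      by simp
    show "eventually (\<lambda>n. (\<Prod>k=1..n. (4 * real k ^ 2) / (4 * real k ^ 2 - 1)) * (4 + 2 * (1 / real n)) =
        exp (2 * (2 * L n - L (2 * n)))) sequentially"
      using eventually_gt_at_top[of 0]
    proof eventually_elim
      case (elim n)
      have "2 * (2 * L n - L (2 * n)) =
          ln ((2 ^ n * fact n) ^ 4 / (fact (2 * n)) ^ 2 * (2 / real n))"
        using elim by (simp add: L_def ln_mult ln_div ln_realpow algebra_simps)
      then have "exp (2 * (2 * L n - L (2 * n))) = (2 ^ n * fact n) ^ 4 / (fact (2 * n)) ^ 2 * (2 / real n)"
        using elim by simp
      then show ?case
        unfolding wallis_product_eq_fact using elim by (simp add: divide_simps) (simp add: algebra_simps)
    qed
  qed
  ultimately have "exp (2 * l) = 2 * pi"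
    using LIMSEQ_unique by fastforce
  then have l: "l = ln (2 * pi) / 2" by (metis ln_exp nonzero_mult_div_cancel_left zero_neq_numeral)
  obtain m where m: "n = Suc m" using assms by (cases n) auto
  have "l \<le> L n"
    unfolding m using \<open>(\<lambda>n. L (Suc n)) \<longlonglongrightarrow> l\<close> anti by (intro decseq_ge) (auto simp: decseq_def)
  then have "exp (l + (real n + 1/2) * ln (real n) - real n) \<le> exp (ln (fact n))"
    unfolding L_def exp_le_cancel_iff by linarith
  also have "exp (l + (real n + 1/2) * ln (real n) - real n) = exp (ln (sqrt (2 * pi * real n) * (real n / exp 1) ^ n))"
    using assms by (simp add: l ln_mult ln_sqrt ln_realpow ln_div algebra_simps add_divide_distrib)
  finally show ?thesis using assms by simp
qed

section \<open>A barrier principle for differential inequalities\<close>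

text \<open>
  At the first time at which some \<open>\<bar>u i\<bar>\<close> reaches \<open>V i\<close>, all other components are still within
  their barriers and \<open>V i - \<bar>u i\<bar>\<close> has just decreased to 0. This contradicts the strict
  inequality between the derivatives at that time. The inequality is required only at touching
  points, with all components within their barriers, which is what allows coupled systems.
\<close>
lemma barrier_bound:
  fixes u V u' V' :: "'i \<Rightarrow> real \<Rightarrow> real"
  assumes fin: "finite A"
    and du: "\<And>i t. i \<in> A \<Longrightarrow> t \<in> {a..b} \<Longrightarrow> (u i has_real_derivative u' i t) (at t within {a..b})"
    and dV: "\<And>i t. i \<in> A \<Longrightarrow> t \<in> {a..b} \<Longrightarrow> (V i has_real_derivative V' i t) (at t within {a..b})"
    and init: "\<And>i. i \<in> A \<Longrightarrow> \<bar>u i a\<bar> < V i a"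
    and barrier: "\<And>i t. i \<in> A \<Longrightarrow> t \<in> {a..b} \<Longrightarrow> (\<And>j. j \<in> A \<Longrightarrow> \<bar>u j t\<bar> \<le> V j t) \<Longrightarrow>
          \<bar>u i t\<bar> = V i t \<Longrightarrow> \<bar>u' i t\<bar> < V' i t"
    and t: "t \<in> {a..b}" and i: "i \<in> A"
  shows "\<bar>u i t\<bar> < V i t"
proof (rule ccontr)
  assume contra: "\<not> \<bar>u i t\<bar> < V i t"
  define g where "g j s = V j s - \<bar>u j s\<bar>" for j s
  have cont: "continuous_on {a..b} (g j)" if "j \<in> A" for j
  proof -
    have "continuous_on {a..b} (u j)" "continuous_on {a..b} (V j)"
      using DERIV_continuous_on[OF du[OF that]] DERIV_continuous_on[OF dV[OF that]] by auto
    then show ?thesis unfolding g_def by (intro continuous_intros)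
  qed
  define B where "B = (\<Union>j\<in>A. {s \<in> {a..b}. g j s \<le> 0})"
  have "closed B"
    unfolding B_def using fin
  proof (rule closed_UN, intro ballI)
    fix j assume "j \<in> A"
    then show "closed {s \<in> {a..b}. g j s \<le> 0}"
      by (intro continuous_on_closed_Collect_le cont continuous_on_const closed_atLeastAtMost)
  qed
  have "B \<noteq> {}" using contra t i by (auto simp: B_def g_def not_less)
  have bdd: "bdd_below B" by (auto simp: B_def intro: bdd_belowI[of _ a])
  define \<tau> where "\<tau> = Inf B"
  have "\<tau> \<in> B" unfolding \<tau>_def using closed_contains_Inf \<open>closed B\<close> \<open>B \<noteq> {}\<close> bdd by blast
  have before: "g j s > 0" if "s \<in> {a..b}" "s < \<tau>" "j \<in> A" for j s
  proof (rule ccontr)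
    assume "\<not> g j s > 0"
    then have "s \<in> B" using that by (auto simp: B_def not_less)
    then show False using cInf_lower[OF _ bdd] that by (force simp: \<tau>_def)
  qed
  obtain k where k: "k \<in> A" "\<tau> \<in> {a..b}" "g k \<tau> \<le> 0" using \<open>\<tau> \<in> B\<close> by (auto simp: B_def)
  have g_init: "g j a > 0" if "j \<in> A" for j using init[OF that] by (simp add: g_def)
  have "a < \<tau>" using k g_init[OF k(1)] by (cases "\<tau> = a") auto
  have g_nonneg: "g j \<tau> \<ge> 0" if j: "j \<in> A" for j
  proof (rule ccontr)
    assume "\<not> g j \<tau> \<ge> 0"
    then obtain s where s: "a \<le> s" "s \<le> \<tau>" "g j s = 0"
      using IVT2'[of "g j" \<tau> 0 a] g_init[OF j] \<open>a < \<tau>\<close> k(2)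
        continuous_on_subset[OF cont[OF j], of "{a..\<tau>}"] by force
    then show False using before[of s j] j k(2) \<open>\<not> g j \<tau> \<ge> 0\<close> by (cases "s = \<tau>") auto
  qed
  have eq: "\<bar>u k \<tau>\<bar> = V k \<tau>" using g_nonneg[OF k(1)] k(3) by (simp add: g_def)
  have slope: "\<bar>u' k \<tau>\<bar> < V' k \<tau>"
    using barrier[OF k(1,2) _ eq] g_nonneg by (simp add: g_def)
  \<comment> \<open>With the sign of \<open>u k\<close> at \<open>\<tau>\<close> frozen, the gap \<open>h\<close> is differentiable, agrees with \<open>g k\<close> at
      \<open>\<tau>\<close> and is never below it.\<close>
  define \<sigma> :: real where "\<sigma> = (if u k \<tau> \<ge> 0 then 1 else -1)"
  define h where "h s = V k s - \<sigma> * u k s" for s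
  have "(h has_real_derivative V' k \<tau> - \<sigma> * u' k \<tau>) (at \<tau> within {a..b})"
    unfolding h_def by (intro derivative_intros du dV k DERIV_cmult)
  moreover have "V' k \<tau> - \<sigma> * u' k \<tau> > 0" using slope by (auto simp: \<sigma>_def)
  ultimately obtain d where d: "d > 0" "\<And>e. e > 0 \<Longrightarrow> \<tau> - e \<in> {a..b} \<Longrightarrow> e < d \<Longrightarrow> h (\<tau> - e) < h \<tau>"
    using has_real_derivative_pos_inc_left by blast
  define e where "e = min (d / 2) (\<tau> - a)"
  have e: "e > 0" "e < d" "\<tau> - e \<in> {a..b}" using d(1) \<open>a < \<tau>\<close> k(2) by (auto simp: e_def)
  have "h \<tau> = 0" using eq by (auto simp: h_def \<sigma>_def)
  then have "h (\<tau> - e) < 0" using d(2)[of e] e by simp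
  moreover have "h (\<tau> - e) \<ge> g k (\<tau> - e)" by (auto simp: h_def g_def \<sigma>_def)
  ultimately show False using before[OF e(3) _ k(1)] e(1) by auto
qed

section \<open>Monomials and power series in several variables\<close>

lemma mi_degree_add: "mi_degree (\<alpha> + \<beta>) = mi_degree \<alpha> + mi_degree \<beta>"
  by (simp add: mi_degree_def sum.distrib)

lemma mi_degree_axis: "mi_degree (axis j 1) = 1"
  by (simp add: mi_degree_def axis_def)

lemma axis_add_diff: "\<alpha> $ j > 0 \<Longrightarrow> axis j 1 + (\<alpha> - axis j 1) = (\<alpha> :: nat ^ 'd)"
  by (auto simp: vec_eq_iff axis_def)

lemma mi_degree_diff_axis: "\<alpha> $ j > 0 \<Longrightarrow> Suc (mi_degree (\<alpha> - axis j 1)) = mi_degree \<alpha>"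
  using mi_degree_add[of "axis j 1" "\<alpha> - axis j 1"] axis_add_diff[of \<alpha> j] mi_degree_axis[of j] by simp

lemma monomial_add: "monomial z (\<alpha> + \<beta>) = monomial z \<alpha> * monomial z \<beta>"
  by (simp add: monomial_def power_add prod.distrib)

lemma abs_monomial_le:
  assumes "infnorm z \<le> r"
  shows "\<bar>monomial z \<alpha>\<bar> \<le> r ^ mi_degree \<alpha>"
proof -
  have "\<bar>monomial z \<alpha>\<bar> = (\<Prod>i\<in>UNIV. \<bar>z $ i\<bar> ^ (\<alpha> $ i))"
    by (simp add: monomial_def abs_prod power_abs)
  also have "\<dots> \<le> (\<Prod>i\<in>UNIV. r ^ (\<alpha> $ i))"
    using order_trans[OF component_le_infnorm_cart assms] by (intro prod_mono conjI power_mono) auto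
  also have "\<dots> = r ^ mi_degree \<alpha>"
    by (simp add: mi_degree_def power_sum)
  finally show ?thesis .
qed

lemma monomial_axis: "monomial z (axis j 1) = z $ j"
proof -
  have "monomial z (axis j 1) = (\<Prod>i\<in>UNIV. if i = j then z $ i else 1)"
    unfolding monomial_def by (intro prod.cong) (auto simp: axis_def)
  then show ?thesis by simp
qed

text \<open>
  For \<open>\<alpha> $ j = 0\<close> the truncated difference \<open>\<alpha> - axis j 1\<close> is just \<open>\<alpha>\<close>, but then the \<open>j\<close>-th
  summand is multiplied by 0.
\<close>
lemma has_real_derivative_monomial:
  fixes x :: "real \<Rightarrow> real ^ 'd"
  assumes "(x has_vector_derivative x') (at t within S)"
  shows "((\<lambda>s. monomial (x s) \<alpha>) has_real_derivative
           (\<Sum>j\<in>UNIV. real (\<alpha> $ j) * (monomial (x t) (\<alpha> - axis j 1) * x' $ j))) (at t within S)"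
proof -
  have comp: "((\<lambda>s. x s $ j) has_real_derivative x' $ j) (at t within S)" for j
    unfolding has_real_derivative_iff_has_vector_derivative
    by (rule bounded_linear.has_vector_derivative[OF bounded_linear_vec_nth assms])
  have pow: "((\<lambda>s. (x s $ j) ^ (\<alpha> $ j)) has_real_derivative
      real (\<alpha> $ j) * (x t $ j) ^ (\<alpha> $ j - 1) * x' $ j) (at t within S)" for j
    by (rule DERIV_cong[OF DERIV_power[OF comp]]) simp
  have mon: "(x t $ j) ^ (\<alpha> $ j - 1) * (\<Prod>i\<in>UNIV - {j}. (x t $ i) ^ (\<alpha> $ i)) = monomial (x t) (\<alpha> - axis j 1)" for j
  proof -
    have "monomial (x t) (\<alpha> - axis j 1) =
       (x t $ j) ^ ((\<alpha> - axis j 1) $ j) * (\<Prod>i\<in>UNIV - {j}. (x t $ i) ^ ((\<alpha> - axis j 1) $ i))"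
      unfolding monomial_def by (subst prod.remove[of _ j]) auto
    also have "(\<Prod>i\<in>UNIV - {j}. (x t $ i) ^ ((\<alpha> - axis j 1) $ i)) = (\<Prod>i\<in>UNIV - {j}. (x t $ i) ^ (\<alpha> $ i))"
      by (intro prod.cong) (auto simp: axis_def)
    finally show ?thesis by (simp add: axis_def)
  qed
  have "((\<lambda>s. \<Prod>j\<in>UNIV. (x s $ j) ^ (\<alpha> $ j)) has_derivative
      (\<lambda>h. \<Sum>j\<in>UNIV. real (\<alpha> $ j) * (x t $ j) ^ (\<alpha> $ j - 1) * x' $ j * h *
          (\<Prod>i\<in>UNIV - {j}. (x t $ i) ^ (\<alpha> $ i)))) (at t within S)"
    by (rule has_derivative_prod) (rule pow[unfolded has_field_derivative_def])
  also have "(\<lambda>h. \<Sum>j\<in>UNIV. real (\<alpha> $ j) * (x t $ j) ^ (\<alpha> $ j - 1) * x' $ j * h *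
          (\<Prod>i\<in>UNIV - {j}. (x t $ i) ^ (\<alpha> $ i))) =
      (*) (\<Sum>j\<in>UNIV. real (\<alpha> $ j) * (monomial (x t) (\<alpha> - axis j 1) * x' $ j))"
    unfolding mon[symmetric] sum_distrib_right by (intro ext sum.cong) (auto simp: mult_ac)
  finally show ?thesis
    unfolding has_field_derivative_def monomial_def[of "x _" \<alpha>] .
qed

text \<open>
  Grouped by degree, the terms of degree \<open>m\<close> contribute at most \<open>D (r / R)\<^bsup>m\<^esup>\<close>, a geometric series.
  The estimate holds for every finite part of the tail, hence also for its sum.
\<close>
lemma power_series_tail_bound:
  fixes a :: "nat ^ 'd \<Rightarrow> real" and z :: "real ^ 'd"
  assumes sums: "((\<lambda>\<alpha>. a \<alpha> * monomial z \<alpha>) has_sum F) (UNIV - {0})"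
    and decay: "\<And>k. k \<ge> 1 \<Longrightarrow> (\<Sum>\<alpha>\<in>mi_of_degree k. \<bar>a \<alpha>\<bar>) \<le> D / R ^ k"
    and z: "infnorm z \<le> r" and r: "r < R"
  shows "\<bar>F - (\<Sum>m=1..n. \<Sum>\<alpha>\<in>mi_of_degree m. a \<alpha> * monomial z \<alpha>)\<bar> \<le> D * ((r / R) ^ (n + 1) / (1 - r / R))"
proof -
  have r0: "r \<ge> 0" using z infnorm_pos_le order_trans by blast
  with r have R: "R > 0" by simp
  have "0 \<le> (\<Sum>\<alpha>\<in>mi_of_degree 1. \<bar>a \<alpha>\<bar>)" by (simp add: sum_nonneg)
  also have "\<dots> \<le> D / R" using decay[of 1] by simp
  finally have D: "D \<ge> 0" using R by (simp add: zero_le_divide_iff)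
  define q where "q = r / R"
  have q: "0 \<le> q" "q < 1" using r r0 R by (auto simp: q_def)
  define E where "E = (\<Union>m\<in>{1..n}. mi_of_degree m :: (nat ^ 'd) set)"
  have disj: "mi_of_degree i \<inter> mi_of_degree j = ({} :: (nat ^ 'd) set)" if "i \<noteq> j" for i j
    using that by (auto simp: mi_of_degree_def)
  have finE: "finite E" by (auto simp: E_def finite_mi_of_degree)
  have sumE: "(\<Sum>\<alpha>\<in>E. h \<alpha>) = (\<Sum>m=1..n. \<Sum>\<alpha>\<in>mi_of_degree m. h \<alpha>)" for h :: "nat ^ 'd \<Rightarrow> real"
    unfolding E_def by (rule sum.UNION_disjoint) (auto simp: finite_mi_of_degree disj)
  have deg0: "mi_degree \<alpha> = 0 \<longleftrightarrow> \<alpha> = 0" for \<alpha> :: "nat ^ 'd"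
    by (auto simp: mi_degree_def vec_eq_iff)
  have E_sub: "E \<subseteq> UNIV - {0}"
  proof
    fix \<alpha> assume "\<alpha> \<in> E"
    then have "mi_degree \<alpha> \<noteq> 0" by (auto simp: E_def mi_of_degree_def)
    then show "\<alpha> \<in> UNIV - {0}" unfolding deg0 by simp
  qed
  have tail: "((\<lambda>\<alpha>. a \<alpha> * monomial z \<alpha>) has_sum
      (F - (\<Sum>m=1..n. \<Sum>\<alpha>\<in>mi_of_degree m. a \<alpha> * monomial z \<alpha>))) (UNIV - {0} - E)"
    unfolding sumE[symmetric]
    by (rule has_sum_Diff[OF sums has_sum_finite[OF finE] E_sub])
  have partial: "\<bar>\<Sum>\<alpha>\<in>G. a \<alpha> * monomial z \<alpha>\<bar> \<le> D * (q ^ (n + 1) / (1 - q))"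
    if G: "finite G" "G \<subseteq> UNIV - {0} - E" for G
  proof -
    define K where "K = Max (insert 0 (mi_degree ` G))"
    have G_sub: "G \<subseteq> (\<Union>m\<in>{n+1..K}. mi_of_degree m)"
    proof
      fix \<alpha> assume \<alpha>: "\<alpha> \<in> G"
      then have "\<alpha> \<noteq> 0" "\<alpha> \<notin> E" using G(2) by auto
      then have "mi_degree \<alpha> \<noteq> 0" "mi_degree \<alpha> \<notin> {1..n}"
        unfolding deg0 by (auto simp: E_def mi_of_degree_def)
      moreover have "mi_degree \<alpha> \<le> K" using \<alpha> G(1) by (auto simp: K_def)
      ultimately show "\<alpha> \<in> (\<Union>m\<in>{n+1..K}. mi_of_degree m)" by (auto simp: mi_of_degree_def)
    qed
    have "\<bar>\<Sum>\<alpha>\<in>G. a \<alpha> * monomial z \<alpha>\<bar> \<le> (\<Sum>\<alpha>\<in>G. \<bar>a \<alpha>\<bar> * r ^ mi_degree \<alpha>)"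
      using abs_monomial_le[OF z]
      by (intro order_trans[OF sum_abs] sum_mono) (simp add: abs_mult mult_left_mono)
    also have "\<dots> \<le> (\<Sum>\<alpha>\<in>(\<Union>m\<in>{n+1..K}. mi_of_degree m). \<bar>a \<alpha>\<bar> * r ^ mi_degree \<alpha>)"
      using G_sub r0 by (intro sum_mono2) (auto simp: finite_mi_of_degree)
    also have "\<dots> = (\<Sum>m=n+1..K. \<Sum>\<alpha>\<in>mi_of_degree m. \<bar>a \<alpha>\<bar> * r ^ mi_degree \<alpha>)"
      by (rule sum.UNION_disjoint) (auto simp: finite_mi_of_degree disj)
    also have "\<dots> = (\<Sum>m=n+1..K. (\<Sum>\<alpha>\<in>mi_of_degree m. \<bar>a \<alpha>\<bar>) * r ^ m)"
      by (simp add: sum_distrib_right mi_of_degree_def)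
    also have "\<dots> \<le> (\<Sum>m=n+1..K. D * q ^ m)"
    proof (rule sum_mono)
      fix m assume "m \<in> {n+1..K}"
      then have "(\<Sum>\<alpha>\<in>mi_of_degree m. \<bar>a \<alpha>\<bar>) * r ^ m \<le> D / R ^ m * r ^ m"
        using r0 by (intro mult_right_mono decay) auto
      then show "(\<Sum>\<alpha>\<in>mi_of_degree m. \<bar>a \<alpha>\<bar>) * r ^ m \<le> D * q ^ m"
        by (simp add: q_def power_divide)
    qed
    also have "\<dots> = D * (\<Sum>m=n+1..K. q ^ m)" by (simp add: sum_distrib_left)
    also have "\<dots> \<le> D * (q ^ (n + 1) / (1 - q))"
      using q by (intro mult_left_mono D) (auto simp: sum_gp divide_simps)
    finally show ?thesis .
  qed
  show ?thesis
    unfolding q_def[symmetric]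
  proof (rule tendsto_upperbound[OF tendsto_rabs[OF tail[unfolded has_sum_def]]])
    show "\<forall>\<^sub>F G in finite_subsets_at_top (UNIV - {0} - E).
        \<bar>\<Sum>\<alpha>\<in>G. a \<alpha> * monomial z \<alpha>\<bar> \<le> D * (q ^ (n + 1) / (1 - q))"
      by (rule eventually_finite_subsets_at_top_weakI) (rule partial)
  qed simp
qed

section \<open>Rows of the Carleman matrix\<close>

text \<open>
  The coefficient in column \<open>\<beta>\<close> vanishes unless \<open>\<beta> = \<alpha> - e\<^sub>j + \<gamma>\<close> for a genuine multi-index
  \<open>\<gamma>\<close>; the sum can therefore be taken over \<open>\<gamma>\<close>, whose degree is \<open>l - k + 1\<close>. The weight \<open>g\<close> is
  arbitrary so that the same identity serves for the absolute row sums and for the action of the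
  matrix on monomials.
\<close>
lemma sum_coeff_ext_shift:
  fixes \<alpha> :: "nat ^ 'd"
  assumes j: "\<alpha> $ j > 0" and k: "\<alpha> \<in> mi_of_degree k" and kl: "k \<le> l"
  shows "(\<Sum>\<beta>\<in>mi_of_degree l. coeff_ext c j (mi_int \<beta> - mi_int \<alpha> + axis j 1) t * g \<beta>) =
         (\<Sum>\<gamma>\<in>mi_of_degree (l - k + 1). c j \<gamma> t * g (\<alpha> - axis j 1 + \<gamma>))"
proof -
  define \<phi> where "\<phi> \<gamma> = \<alpha> - axis j 1 + \<gamma>" for \<gamma> :: "nat ^ 'd"
  have diff: "mi_int (\<phi> \<gamma>) - mi_int \<alpha> + axis j 1 = mi_int \<gamma>" for \<gamma>
    using j by (auto simp: vec_eq_iff mi_int_def \<phi>_def axis_def)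
  have deg: "mi_degree (\<phi> \<gamma>) = l \<longleftrightarrow> mi_degree \<gamma> = l - k + 1" for \<gamma>
    using mi_degree_diff_axis[of \<alpha> j] j k kl by (auto simp: \<phi>_def mi_degree_add mi_of_degree_def)
  have coeff: "coeff_ext c j (mi_int (\<phi> \<gamma>) - mi_int \<alpha> + axis j 1) t = c j \<gamma> t"
    if "\<gamma> \<in> mi_of_degree (l - k + 1)" for \<gamma>
  proof -
    have "mi_int \<gamma> \<noteq> 0"
    proof
      assume "mi_int \<gamma> = 0"
      then have "mi_degree \<gamma> = 0" by (simp add: mi_int_def mi_degree_def vec_eq_iff)
      with that show False by (simp add: mi_of_degree_def)
    qed
    then show ?thesis unfolding diff by (simp add: coeff_ext_def mi_int_def)
  qed
  have zero: "coeff_ext c j (mi_int \<beta> - mi_int \<alpha> + axis j 1) t = 0"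
    if \<beta>: "\<beta> \<in> mi_of_degree l - \<phi> ` mi_of_degree (l - k + 1)" for \<beta>
  proof (rule ccontr)
    assume "coeff_ext c j (mi_int \<beta> - mi_int \<alpha> + axis j 1) t \<noteq> 0"
    then have "\<forall>i. 0 \<le> (mi_int \<beta> - mi_int \<alpha> + axis j 1) $ i" unfolding coeff_ext_def by presburger
    then have nonneg: "0 \<le> (mi_int \<beta> - mi_int \<alpha> + axis j 1) $ i" for i by blast
    have le: "(\<alpha> - axis j 1) $ i \<le> \<beta> $ i" for i
      using nonneg[of i] by (cases "i = j") (auto simp: mi_int_def axis_def)
    then have "\<phi> (\<beta> - (\<alpha> - axis j 1)) = \<beta>"
      by (simp add: \<phi>_def vec_eq_iff del: vector_minus_component) simp
    moreover from this have "mi_degree (\<beta> - (\<alpha> - axis j 1)) = l - k + 1"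
      using deg[of "\<beta> - (\<alpha> - axis j 1)"] \<beta> by (simp add: mi_of_degree_def)
    ultimately have "\<beta> \<in> \<phi> ` mi_of_degree (l - k + 1)"
      by (intro image_eqI[of _ _ "\<beta> - (\<alpha> - axis j 1)"]) (simp_all add: mi_of_degree_def)
    with \<beta> show False by simp
  qed
  have "(\<Sum>\<beta>\<in>mi_of_degree l. coeff_ext c j (mi_int \<beta> - mi_int \<alpha> + axis j 1) t * g \<beta>) =
        (\<Sum>\<beta>\<in>\<phi> ` mi_of_degree (l - k + 1). coeff_ext c j (mi_int \<beta> - mi_int \<alpha> + axis j 1) t * g \<beta>)"
  proof (rule sum.mono_neutral_right)
    show "\<phi> ` mi_of_degree (l - k + 1) \<subseteq> mi_of_degree l"
      using deg by (auto simp: mi_of_degree_def)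
  qed (simp_all add: finite_mi_of_degree zero)
  also have "\<dots> = (\<Sum>\<gamma>\<in>mi_of_degree (l - k + 1).
      coeff_ext c j (mi_int (\<phi> \<gamma>) - mi_int \<alpha> + axis j 1) t * g (\<phi> \<gamma>))"
    by (rule sum.reindex[unfolded o_def]) (auto simp: inj_on_def \<phi>_def)
  also have "\<dots> = (\<Sum>\<gamma>\<in>mi_of_degree (l - k + 1). c j \<gamma> t * g (\<phi> \<gamma>))"
    using coeff by (intro sum.cong) auto
  finally show ?thesis by (simp add: \<phi>_def)
qed

lemma carleman_row_sum:
  fixes \<alpha> :: "nat ^ 'd"
  assumes k: "\<alpha> \<in> mi_of_degree k" and kl: "k \<le> l"
  shows "(\<Sum>\<beta>\<in>mi_of_degree l. carleman_entry c t \<alpha> \<beta> * g \<beta>) =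
         (\<Sum>j\<in>UNIV. real (\<alpha> $ j) * (\<Sum>\<gamma>\<in>mi_of_degree (l - k + 1). c j \<gamma> t * g (\<alpha> - axis j 1 + \<gamma>)))"
proof -
  have "(\<Sum>\<beta>\<in>mi_of_degree l. carleman_entry c t \<alpha> \<beta> * g \<beta>) =
     (\<Sum>j\<in>UNIV. real (\<alpha> $ j) *
        (\<Sum>\<beta>\<in>mi_of_degree l. coeff_ext c j (mi_int \<beta> - mi_int \<alpha> + axis j 1) t * g \<beta>))"
    unfolding carleman_entry_def sum_distrib_right sum_distrib_left
    by (subst sum.swap) (simp add: mult.assoc)
  also have "\<dots> = (\<Sum>j\<in>UNIV. real (\<alpha> $ j) *
      (\<Sum>\<gamma>\<in>mi_of_degree (l - k + 1). c j \<gamma> t * g (\<alpha> - axis j 1 + \<gamma>)))"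
  proof (rule sum.cong[OF refl])
    fix j :: 'd
    show "real (\<alpha> $ j) *
        (\<Sum>\<beta>\<in>mi_of_degree l. coeff_ext c j (mi_int \<beta> - mi_int \<alpha> + axis j 1) t * g \<beta>) =
      real (\<alpha> $ j) * (\<Sum>\<gamma>\<in>mi_of_degree (l - k + 1). c j \<gamma> t * g (\<alpha> - axis j 1 + \<gamma>))"
      using sum_coeff_ext_shift[OF _ k kl, of j c t g] by (cases "\<alpha> $ j = 0") auto
  qed
  finally show ?thesis .
qed

text \<open>
  The absolute row sum is at most the row sum for the family \<open>\<bar>c\<bar>\<close>, where each direction \<open>j\<close>
  contributes \<open>\<alpha> $ j\<close> times a full sum of coefficients of degree \<open>l - k + 1\<close>; the numbers
  \<open>\<alpha> $ j\<close> add up to \<open>k\<close>.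
\<close>
lemma sum_abs_carleman_row_le:
  fixes \<alpha> :: "nat ^ 'd"
  assumes k: "\<alpha> \<in> mi_of_degree k" and kl: "k \<le> l"
    and decay: "\<And>j m. m \<ge> 1 \<Longrightarrow> (\<Sum>\<gamma>\<in>mi_of_degree m. \<bar>c j \<gamma> t\<bar>) \<le> D / R ^ m"
  shows "(\<Sum>\<beta>\<in>mi_of_degree l. \<bar>carleman_entry c t \<alpha> \<beta>\<bar>) \<le> real k * (D / R ^ (l - k + 1))"
proof -
  define c' where "c' j \<gamma> s = \<bar>c j \<gamma> s\<bar>" for j \<gamma> s
  have "\<bar>carleman_entry c t \<alpha> \<beta>\<bar> \<le> carleman_entry c' t \<alpha> \<beta> * 1" for \<beta>
    unfolding carleman_entry_def mult_1_right
    by (rule order_trans[OF sum_abs]) (auto intro!: sum_mono simp: abs_mult coeff_ext_def c'_def)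
  then have "(\<Sum>\<beta>\<in>mi_of_degree l. \<bar>carleman_entry c t \<alpha> \<beta>\<bar>) \<le> (\<Sum>\<beta>\<in>mi_of_degree l. carleman_entry c' t \<alpha> \<beta> * 1)"
    by (rule sum_mono)
  also have "\<dots> = (\<Sum>j\<in>UNIV. real (\<alpha> $ j) * (\<Sum>\<gamma>\<in>mi_of_degree (l - k + 1). \<bar>c j \<gamma> t\<bar>))"
    unfolding carleman_row_sum[OF k kl] by (simp add: c'_def)
  also have "\<dots> \<le> (\<Sum>j\<in>UNIV. real (\<alpha> $ j) * (D / R ^ (l - k + 1)))"
    by (intro sum_mono mult_left_mono decay) auto
  also have "\<dots> = real k * (D / R ^ (l - k + 1))"
    unfolding sum_distrib_right[symmetric] of_nat_sum[symmetric] using k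
    by (simp add: mi_of_degree_def mi_degree_def del: of_nat_sum)
  finally show ?thesis .
qed

text \<open>
  The monomials fail to solve the truncated Carleman system only through the terms that were cut
  off. By the shift identity, cutting the system off after degree \<open>N\<close> amounts to replacing \<open>F $ j\<close> in the chain rule by its Taylor
  polynomial of degree \<open>N - k + 1\<close>, so only a power series tail has to be estimated.
\<close>
lemma carleman_truncation_residual:
  fixes \<alpha> :: "nat ^ 'd" and z F :: "real ^ 'd"
  assumes k: "\<alpha> \<in> mi_of_degree k" and kN: "k \<le> N"
    and sums: "\<And>j. ((\<lambda>\<gamma>. c j \<gamma> t * monomial z \<gamma>) has_sum F $ j) (UNIV - {0})"
    and decay: "\<And>j m. m \<ge> 1 \<Longrightarrow> (\<Sum>\<gamma>\<in>mi_of_degree m. \<bar>c j \<gamma> t\<bar>) \<le> D / R ^ m"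
    and z: "infnorm z \<le> r" and r: "r < R"
  shows "\<bar>(\<Sum>j\<in>UNIV. real (\<alpha> $ j) * (monomial z (\<alpha> - axis j 1) * F $ j)) -
          (\<Sum>l=k..N. \<Sum>\<beta>\<in>mi_of_degree l. carleman_entry c t \<alpha> \<beta> * monomial z \<beta>)\<bar>
         \<le> real k * (r ^ (k - 1) * (D * ((r / R) ^ (N - k + 2) / (1 - r / R))))"
proof -
  define P where "P j = (\<Sum>m=1..N-k+1. \<Sum>\<gamma>\<in>mi_of_degree m. c j \<gamma> t * monomial z \<gamma>)" for j
  define B where "B = D * ((r / R) ^ (N - k + 2) / (1 - r / R))"
  have tail: "\<bar>F $ j - P j\<bar> \<le> B" for j
    using power_series_tail_bound[OF sums decay z r, of j "N - k + 1"]
    by (simp add: P_def B_def)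
  have r0: "r \<ge> 0" using z infnorm_pos_le order_trans by blast
  have shift: "(\<Sum>l=k..N. h (l - k + 1)) = (\<Sum>m=1..N-k+1. h m)" for h :: "nat \<Rightarrow> real"
    using kN by (intro sum.reindex_bij_witness[of _ "\<lambda>m. m + k - 1" "\<lambda>l. l - k + 1"]) auto
  have "(\<Sum>l=k..N. \<Sum>\<beta>\<in>mi_of_degree l. carleman_entry c t \<alpha> \<beta> * monomial z \<beta>) =
    (\<Sum>l=k..N. \<Sum>j\<in>UNIV. real (\<alpha> $ j) * (\<Sum>\<gamma>\<in>mi_of_degree (l - k + 1).
        c j \<gamma> t * monomial z (\<alpha> - axis j 1 + \<gamma>)))"
    by (intro sum.cong refl carleman_row_sum[OF k]) auto
  also have "\<dots> = (\<Sum>j\<in>UNIV. real (\<alpha> $ j) * (\<Sum>l=k..N. \<Sum>\<gamma>\<in>mi_of_degree (l - k + 1).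
        c j \<gamma> t * monomial z (\<alpha> - axis j 1 + \<gamma>)))"
    unfolding sum_distrib_left by (rule sum.swap)
  also have "\<dots> = (\<Sum>j\<in>UNIV. real (\<alpha> $ j) * (monomial z (\<alpha> - axis j 1) * P j))"
    unfolding shift[of "\<lambda>m. \<Sum>\<gamma>\<in>mi_of_degree m. c _ \<gamma> t * monomial z (\<alpha> - axis _ 1 + \<gamma>)"]
    unfolding P_def monomial_add sum_distrib_left
    by (intro sum.cong refl) (simp only: mult_ac)
  finally have "(\<Sum>j\<in>UNIV. real (\<alpha> $ j) * (monomial z (\<alpha> - axis j 1) * F $ j)) -
          (\<Sum>l=k..N. \<Sum>\<beta>\<in>mi_of_degree l. carleman_entry c t \<alpha> \<beta> * monomial z \<beta>) =
        (\<Sum>j\<in>UNIV. real (\<alpha> $ j) * (monomial z (\<alpha> - axis j 1) * (F $ j - P j)))"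
    by (simp add: right_diff_distrib sum_subtractf)
  also have "\<bar>\<dots>\<bar> \<le> (\<Sum>j\<in>UNIV. real (\<alpha> $ j) * (r ^ (k - 1) * B))"
  proof (rule order_trans[OF sum_abs], rule sum_mono)
    fix j :: 'd
    have "\<bar>monomial z (\<alpha> - axis j 1) * (F $ j - P j)\<bar> \<le> r ^ (k - 1) * B" if "\<alpha> $ j > 0"
    proof -
      have "mi_degree (\<alpha> - axis j 1) = k - 1"
        using mi_degree_diff_axis[OF that] k by (simp add: mi_of_degree_def)
      then show ?thesis
        unfolding abs_mult using tail[of j] abs_monomial_le[OF z, of "\<alpha> - axis j 1"] r0
        by (intro mult_mono) auto
    qed
    then show "\<bar>real (\<alpha> $ j) * (monomial z (\<alpha> - axis j 1) * (F $ j - P j))\<bar> \<le> real (\<alpha> $ j) * (r ^ (k - 1) * B)"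
      by (cases "\<alpha> $ j = 0") (auto simp: abs_mult intro!: mult_left_mono)
  qed
  also have "\<dots> = real k * (r ^ (k - 1) * B)"
    unfolding sum_distrib_right[symmetric] of_nat_sum[symmetric] using k
    by (simp add: mi_of_degree_def mi_degree_def del: of_nat_sum)
  finally show ?thesis by (simp add: B_def)
qed

section \<open>Growth of the solution\<close>

lemma infnorm_le_cart:
  fixes v :: "real ^ 'd"
  assumes "\<And>j. \<bar>v $ j\<bar> \<le> B"
  shows "infnorm v \<le> B"
  unfolding infnorm_cart by (rule cSup_least) (use assms in auto)

text \<open>
  As long as the norm of the solution is at most \<open>v < \<rho>\<close>, each component of the right-hand side is
  at most \<open>D v / (R - v) < D v / (R - \<rho>)\<close>, so an exponential with rate \<open>D / (R - \<rho>)\<close> is a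
  barrier. The hypothesis \<open>small\<close> keeps this barrier below \<open>\<rho>\<close> on the whole interval.
\<close>
lemma solution_growth:
  fixes x :: "real \<Rightarrow> real ^ 'd"
  assumes ode: "\<And>t. t \<in> {t0..t1} \<Longrightarrow> (x has_vector_derivative f t (x t)) (at t within {t0..t1})"
    and sums: "\<And>t z j. t \<in> {t0..t1} \<Longrightarrow> infnorm z < R \<Longrightarrow>
          ((\<lambda>\<gamma>. c j \<gamma> t * monomial z \<gamma>) has_sum f t z $ j) (UNIV - {0})"
    and decay: "\<And>t j m. t \<in> {t0..t1} \<Longrightarrow> m \<ge> 1 \<Longrightarrow> (\<Sum>\<gamma>\<in>mi_of_degree m. \<bar>c j \<gamma> t\<bar>) \<le> D / R ^ m"
    and D: "D > 0" and \<rho>: "\<rho> < R"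
    and x0: "infnorm (x t0) > 0"
    and small: "infnorm (x t0) * exp (D / (R - \<rho>) * (t1 - t0)) < \<rho>"
    and t: "t \<in> {t0..t1}"
  shows "infnorm (x t) \<le> infnorm (x t0) * exp (D / (R - \<rho>) * (t - t0))"
proof -
  define \<kappa> where "\<kappa> = D / (R - \<rho>)"
  have \<kappa>: "\<kappa> > 0" using D \<rho> by (simp add: \<kappa>_def)
  define r0 where "r0 = infnorm (x t0)"
  \<comment> \<open>A barrier must start strictly above the solution, so it starts at some \<open>r > r0\<close>; as long as
      \<open>r < r2\<close> it also stays below \<open>\<rho>\<close>. In the end \<open>r\<close> tends to \<open>r0\<close>.\<close>
  define r2 where "r2 = \<rho> / exp (\<kappa> * (t1 - t0))"
  have "r0 < r2" using small by (simp add: r0_def r2_def \<kappa>_def field_simps)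
  have strict: "\<bar>x s $ j\<bar> < r * exp (\<kappa> * (s - t0))" if r: "r0 < r" "r < r2" and s: "s \<in> {t0..t1}" for r s j
  proof -
    have r_pos: "r > 0" using x0 r by (simp add: r0_def)
    have V_le: "r * exp (\<kappa> * (\<tau> - t0)) < \<rho>" if "\<tau> \<in> {t0..t1}" for \<tau>
    proof -
      have "r * exp (\<kappa> * (\<tau> - t0)) \<le> r * exp (\<kappa> * (t1 - t0))"
        using that \<kappa> r_pos by simp
      also have "\<dots> < \<rho>" using r by (simp add: r2_def field_simps)
      finally show ?thesis .
    qed
    show ?thesis
    proof (rule barrier_bound[of UNIV t0 t1 "\<lambda>i s. x s $ i" "\<lambda>i s. f s (x s) $ i"
          "\<lambda>i s. r * exp (\<kappa> * (s - t0))" "\<lambda>i s. \<kappa> * (r * exp (\<kappa> * (s - t0)))"])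
      show "((\<lambda>s. x s $ i) has_real_derivative f \<tau> (x \<tau>) $ i) (at \<tau> within {t0..t1})"
        if "\<tau> \<in> {t0..t1}" for i \<tau>
        unfolding has_real_derivative_iff_has_vector_derivative
        by (rule bounded_linear.has_vector_derivative[OF bounded_linear_vec_nth ode[OF that]])
      show "((\<lambda>s. r * exp (\<kappa> * (s - t0))) has_real_derivative \<kappa> * (r * exp (\<kappa> * (\<tau> - t0)))) (at \<tau> within {t0..t1})" for \<tau>
        by (auto intro!: derivative_eq_intros)
      show "\<bar>x t0 $ i\<bar> < r * exp (\<kappa> * (t0 - t0))" for i
        using component_le_infnorm_cart[of "x t0" i] r by (simp add: r0_def)
      show "\<bar>f \<tau> (x \<tau>) $ i\<bar> < \<kappa> * (r * exp (\<kappa> * (\<tau> - t0)))"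
        if \<tau>: "\<tau> \<in> {t0..t1}" and le: "\<And>j. j \<in> UNIV \<Longrightarrow> \<bar>x \<tau> $ j\<bar> \<le> r * exp (\<kappa> * (\<tau> - t0))" for i \<tau>
      proof -
        define v where "v = r * exp (\<kappa> * (\<tau> - t0))"
        have v: "0 < v" "v < \<rho>" using V_le[OF \<tau>] r_pos by (auto simp: v_def)
        have nrm: "infnorm (x \<tau>) \<le> v" using le by (intro infnorm_le_cart) (simp add: v_def)
        have xR: "infnorm (x \<tau>) < R" and "v < R" using nrm v \<rho> by auto
        have "\<bar>f \<tau> (x \<tau>) $ i\<bar> \<le> D * ((v / R) / (1 - v / R))"
          using power_series_tail_bound[where a = "\<lambda>\<gamma>. c i \<gamma> \<tau>" and n = 0,
              OF sums[OF \<tau> xR] decay[OF \<tau>] nrm \<open>v < R\<close>] by simp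
        also have "\<dots> = D * v / (R - v)" using v \<rho> by (simp add: field_simps)
        also have "\<dots> < D * v / (R - \<rho>)"
          using v \<rho> D by (intro divide_strict_left_mono mult_pos_pos) auto
        finally show ?thesis by (simp add: v_def \<kappa>_def)
      qed
    qed (use s in auto)
  qed
  have "\<bar>x t $ j\<bar> \<le> r0 * exp (\<kappa> * (t - t0))" for j
  proof -
    have "\<bar>x t $ j\<bar> / exp (\<kappa> * (t - t0)) \<le> r0"
      using strict[OF _ _ t, of _ j]
      by (intro dense_ge_bounded[OF \<open>r0 < r2\<close>]) (simp add: divide_le_eq less_imp_le)
    then show ?thesis by (simp add: divide_le_eq)
  qed
  then show ?thesis unfolding \<kappa>_def[symmetric] r0_def[symmetric] by (rule infnorm_le_cart)
qed

section \<open>Error of the finite sections\<close>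

text \<open>
  The sum telescopes: with \<open>s\<^sub>k = N\<^bsup>N-k\<^esup> / (N-k)!\<close> one has \<open>N (s\<^sub>k - s\<^sub>k\<^sub>+\<^sub>1) = k s\<^sub>k\<close> for
  \<open>k < N\<close>, and the last term is \<open>s\<^sub>N = 1\<close>.
\<close>
lemma sum_comparison_weights:
  assumes "k \<le> N" "N \<ge> 1"
  shows "(\<Sum>l=k..N. real l / real N * (real N ^ (N - l) / fact (N - l))) = real N ^ (N - k) / fact (N - k)"
  using assms(1)
proof (induction rule: inc_induct)
  case base
  then show ?case using assms(2) by simp
next
  case (step k)
  obtain m where m: "N - k = Suc m" "N - Suc k = m" "real N = real k + real m + 1"
    using step.hyps by (metis Suc_diff_Suc add.commute add_Suc_right le_add_diff_inverse less_imp_le of_nat_Suc of_nat_add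
        plus_1_eq_Suc add.assoc)
  have "real k / real N * (real N ^ Suc m / fact (Suc m)) + real N ^ m / fact m = real N ^ Suc m / fact (Suc m)"
    using assms(2) by (simp add: divide_simps) (simp add: m(3) algebra_simps)
  then show ?case
    using step by (simp add: sum.atLeast_Suc_atMost m)
qed

text \<open>
  The right-hand side is \<open>R\<^bsup>k\<^esup> q\<^bsup>N+1\<^esup> / (1 - q)\<close> times a solution \<open>w\<^sub>k\<close> of the scalar comparison
  system \<open>w\<^sub>k' = a k (\<Sum>l=k..N. w\<^sub>l) + a k\<close> with \<open>a = D / R\<close> and \<open>q = M / R\<close>. The correction by
  1 at \<open>k = N\<close> absorbs the inhomogeneous term: it makes \<open>1 + (\<Sum>l=k..N. w\<^sub>l)\<close> a pure exponential.
  Since a barrier has to be strict, a term \<open>\<epsilon> e\<^bsup>K(t - t0)\<^esup>\<close> is added inside the factor \<open>R\<^bsup>k\<^esup>\<close>, and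
  \<open>\<epsilon>\<close> tends to 0 at the end.
\<close>
lemma carleman_error_bound:
  fixes x :: "real \<Rightarrow> real ^ 'd" and y :: "nat \<Rightarrow> real \<Rightarrow> nat ^ 'd \<Rightarrow> real"
  assumes ode: "\<And>t. t \<in> {t0..t1} \<Longrightarrow> (x has_vector_derivative f t (x t)) (at t within {t0..t1})"
    and sums: "\<And>t z j. t \<in> {t0..t1} \<Longrightarrow> infnorm z < R \<Longrightarrow>
          ((\<lambda>\<gamma>. c j \<gamma> t * monomial z \<gamma>) has_sum f t z $ j) (UNIV - {0})"
    and decay: "\<And>t j m. t \<in> {t0..t1} \<Longrightarrow> m \<ge> 1 \<Longrightarrow> (\<Sum>\<gamma>\<in>mi_of_degree m. \<bar>c j \<gamma> t\<bar>) \<le> D / R ^ m"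
    and D: "D > 0"
    and bound: "\<And>t. t \<in> {t0..t1} \<Longrightarrow> infnorm (x t) \<le> M" and M: "0 \<le> M" "M < R"
    and y: "finite_section_solution c t0 (x t0) {t0..t1} N y"
    and k: "k \<in> {1..N}" and \<alpha>: "\<alpha> \<in> mi_of_degree k" and t: "t \<in> {t0..t1}"
  shows "\<bar>y k t \<alpha> - monomial (x t) \<alpha>\<bar> \<le>
    R ^ k * ((M / R) ^ (N + 1) / (1 - M / R) *
      (real k / real N * (real N ^ (N - k) / fact (N - k)) * exp (D / R * real N * (t - t0))
        - (if k = N then 1 else 0)))"
proof -
  have R: "R > 0" using M by simp
  have N: "N \<ge> 1" using k by simp
  define a where "a = D / R"
  have a: "a > 0" using D R by (simp add: a_def)
  define q where "q = M / R"
  have q: "0 \<le> q" "q < 1" using M R by (auto simp: q_def)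
  define c0 where "c0 = q ^ (N + 1) / (1 - q)"
  have c0: "c0 \<ge> 0" using q by (simp add: c0_def)
  define s where "s l = real N ^ (N - l) / fact (N - l)" for l
  have s_nonneg: "s l \<ge> 0" for l by (simp add: s_def)
  define E where "E \<tau> = exp (a * real N * (\<tau> - t0))" for \<tau>
  define w where "w l \<tau> = real l / real N * s l * E \<tau> - (if l = N then 1 else 0)" for l \<tau>
  have w_nonneg: "w l \<tau> \<ge> 0" if "\<tau> \<in> {t0..t1}" for l \<tau>
  proof -
    have "E \<tau> \<ge> 1" using a that by (simp add: E_def)
    then show ?thesis using N s_nonneg[of l] by (auto simp: w_def s_def)
  qed
  have w_sum: "(\<Sum>l=m..N. w l \<tau>) = s m * E \<tau> - 1" if "m \<le> N" for m \<tau>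
  proof -
    have "(\<Sum>l=m..N. w l \<tau>) = (\<Sum>l=m..N. real l / real N * s l) * E \<tau> - (\<Sum>l=m..N. if l = N then 1 else 0)"
      by (simp add: w_def sum_subtractf sum_distrib_right)
    also have "(\<Sum>l=m..N. real l / real N * s l) = s m"
      unfolding s_def by (rule sum_comparison_weights[OF that N])
    finally show ?thesis using that by simp
  qed
  \<comment> \<open>The perturbation \<open>\<epsilon> G\<close> enters the row of degree \<open>n\<close> with total weight
      \<open>a n (N + 1 - n) \<le> a N\<^sup>2\<close>, which \<open>K\<close> has to exceed.\<close>
  define K where "K = a * (real N * real N) + 1"
  define G where "G \<tau> = exp (K * (\<tau> - t0))" for \<tau>
  define A :: "(nat ^ 'd) set" where "A = (\<Union>l\<in>{1..N}. mi_of_degree l)"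
  define u where "u \<beta> \<tau> = y (mi_degree \<beta>) \<tau> \<beta> - monomial (x \<tau>) \<beta>" for \<beta> \<tau>
  define F where "F \<beta> \<tau> = (\<Sum>j\<in>UNIV. real (\<beta> $ j) * (monomial (x \<tau>) (\<beta> - axis j 1) * f \<tau> (x \<tau>) $ j))" for \<beta> \<tau>
  define u' where "u' \<beta> \<tau> = (\<Sum>l=mi_degree \<beta>..N. \<Sum>\<gamma>\<in>mi_of_degree l. carleman_entry c \<tau> \<beta> \<gamma> * y l \<tau> \<gamma>) - F \<beta> \<tau>" for \<beta> \<tau>
  have A_deg: "mi_degree \<beta> \<in> {1..N}" if "\<beta> \<in> A" for \<beta>
    using that by (auto simp: A_def mi_of_degree_def)
  have strict: "\<bar>u \<alpha> t\<bar> < R ^ k * (c0 * w k t + \<epsilon> * G t)" if \<epsilon>: "\<epsilon> > 0" for \<epsilon>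
  proof -
    define V where "V \<beta> \<tau> = R ^ mi_degree \<beta> * (c0 * w (mi_degree \<beta>) \<tau> + \<epsilon> * G \<tau>)" for \<beta> :: "nat ^ 'd" and \<tau>
    define V' where "V' \<beta> \<tau> = R ^ mi_degree \<beta> *
        (c0 * (a * real (mi_degree \<beta>) * s (mi_degree \<beta>) * E \<tau>) + \<epsilon> * (K * G \<tau>))" for \<beta> :: "nat ^ 'd" and \<tau>
    have "\<bar>u \<alpha> t\<bar> < V \<alpha> t"
    proof (rule barrier_bound[of A t0 t1 u u' V V'])
      show "finite A" by (auto simp: A_def finite_mi_of_degree)
      show "t \<in> {t0..t1}" by fact
      show "\<alpha> \<in> A" using k \<alpha> by (auto simp: A_def)
    next
      fix \<beta> \<tau> assume \<beta>: "\<beta> \<in> A" and \<tau>: "\<tau> \<in> {t0..t1}"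
      show "(u \<beta> has_real_derivative u' \<beta> \<tau>) (at \<tau> within {t0..t1})"
        unfolding u_def u'_def F_def
        using y A_deg[OF \<beta>] \<tau> unfolding finite_section_solution_def
        by (intro DERIV_diff has_real_derivative_monomial ode) (auto simp: mi_of_degree_def)
      have E': "(E has_real_derivative a * real N * E \<tau>) (at \<tau> within {t0..t1})"
        unfolding E_def by (auto intro!: derivative_eq_intros)
      have G': "(G has_real_derivative K * G \<tau>) (at \<tau> within {t0..t1})"
        unfolding G_def by (auto intro!: derivative_eq_intros)
      show "(V \<beta> has_real_derivative V' \<beta> \<tau>) (at \<tau> within {t0..t1})"
        unfolding V_def w_def V'_def
        using N by (auto intro!: derivative_eq_intros E' G')
    next
      fix \<beta> assume \<beta>: "\<beta> \<in> A"
      have t0: "t0 \<in> {t0..t1}" using t by simp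
      have "u \<beta> t0 = 0"
        using y A_deg[OF \<beta>] by (simp add: finite_section_solution_def u_def mi_of_degree_def)
      moreover have "0 < V \<beta> t0"
        unfolding V_def using R \<epsilon> c0 w_nonneg[OF t0]
        by (intro mult_pos_pos add_nonneg_pos) (auto simp: G_def)
      ultimately show "\<bar>u \<beta> t0\<bar> < V \<beta> t0" by simp
    next
      fix \<beta> \<tau>
      assume \<beta>: "\<beta> \<in> A" and \<tau>: "\<tau> \<in> {t0..t1}" and le: "\<And>\<gamma>. \<gamma> \<in> A \<Longrightarrow> \<bar>u \<gamma> \<tau>\<bar> \<le> V \<gamma> \<tau>"
      define n where "n = mi_degree \<beta>"
      have n: "1 \<le> n" "n \<le> N" and \<beta>n: "\<beta> \<in> mi_of_degree n"
        using A_deg[OF \<beta>] by (auto simp: n_def mi_of_degree_def)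
      define v where "v l = c0 * w l \<tau> + \<epsilon> * G \<tau>" for l
      have v: "v l \<ge> 0" for l using c0 w_nonneg[OF \<tau>] \<epsilon> by (simp add: v_def G_def)
      have aR: "a * R ^ n = D * R ^ (n - 1)"
        using n R by (cases n) (auto simp: a_def)
      define S where "S = (\<Sum>l=n..N. \<Sum>\<gamma>\<in>mi_of_degree l. carleman_entry c \<tau> \<beta> \<gamma> * monomial (x \<tau>) \<gamma>)"
      have "u' \<beta> \<tau> = (\<Sum>l=n..N. \<Sum>\<gamma>\<in>mi_of_degree l. carleman_entry c \<tau> \<beta> \<gamma> * u \<gamma> \<tau>) - (F \<beta> \<tau> - S)"
      proof -
        have "(\<Sum>l=n..N. \<Sum>\<gamma>\<in>mi_of_degree l. carleman_entry c \<tau> \<beta> \<gamma> * u \<gamma> \<tau>) =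
          (\<Sum>l=n..N. \<Sum>\<gamma>\<in>mi_of_degree l. carleman_entry c \<tau> \<beta> \<gamma> * y l \<tau> \<gamma>
              - carleman_entry c \<tau> \<beta> \<gamma> * monomial (x \<tau>) \<gamma>)"
          by (intro sum.cong refl) (auto simp: u_def mi_of_degree_def right_diff_distrib)
        then show ?thesis by (simp add: u'_def S_def n_def sum_subtractf)
      qed
      also have "\<bar>\<dots>\<bar> \<le> (\<Sum>l=n..N. real n * (a * R ^ n) * v l) + real n * (a * R ^ n) * c0"
      proof (rule order_trans[OF abs_triangle_ineq4 add_mono])
        show "\<bar>\<Sum>l=n..N. \<Sum>\<gamma>\<in>mi_of_degree l. carleman_entry c \<tau> \<beta> \<gamma> * u \<gamma> \<tau>\<bar> \<le>
            (\<Sum>l=n..N. real n * (a * R ^ n) * v l)"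
        proof (rule order_trans[OF sum_abs], rule sum_mono)
          fix l assume l: "l \<in> {n..N}"
          have "\<bar>\<Sum>\<gamma>\<in>mi_of_degree l. carleman_entry c \<tau> \<beta> \<gamma> * u \<gamma> \<tau>\<bar> \<le>
              (\<Sum>\<gamma>\<in>mi_of_degree l. \<bar>carleman_entry c \<tau> \<beta> \<gamma>\<bar> * (R ^ l * v l))"
          proof (rule order_trans[OF sum_abs], rule sum_mono)
            fix \<gamma> :: "nat ^ 'd" assume \<gamma>: "\<gamma> \<in> mi_of_degree l"
            then have "\<gamma> \<in> A" using l n by (auto simp: A_def)
            from le[OF this] \<gamma> have "\<bar>u \<gamma> \<tau>\<bar> \<le> R ^ l * v l"
              by (simp add: V_def v_def mi_of_degree_def)
            then show "\<bar>carleman_entry c \<tau> \<beta> \<gamma> * u \<gamma> \<tau>\<bar> \<le> \<bar>carleman_entry c \<tau> \<beta> \<gamma>\<bar> * (R ^ l * v l)"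
              unfolding abs_mult by (rule mult_left_mono) simp
          qed
          also have "\<dots> = (\<Sum>\<gamma>\<in>mi_of_degree l. \<bar>carleman_entry c \<tau> \<beta> \<gamma>\<bar>) * (R ^ l * v l)"
            by (simp add: sum_distrib_right)
          also have "\<dots> \<le> real n * (D / R ^ (l - n + 1)) * (R ^ l * v l)"
            using l R v by (intro mult_right_mono sum_abs_carleman_row_le[OF \<beta>n] decay \<tau>) auto
          also have "R ^ l = R ^ (l - n + 1) * R ^ (n - 1)"
          proof -
            have "l = (l - n + 1) + (n - 1)" using l n by simp
            then show ?thesis by (metis power_add)
          qed
          also have "real n * (D / R ^ (l - n + 1)) * (R ^ (l - n + 1) * R ^ (n - 1) * v l) =
              real n * (a * R ^ n) * v l"
            using R by (simp add: aR)
          finally show "\<bar>\<Sum>\<gamma>\<in>mi_of_degree l. carleman_entry c \<tau> \<beta> \<gamma> * u \<gamma> \<tau>\<bar> \<le> real n * (a * R ^ n) * v l" .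
        qed
        have xR: "infnorm (x \<tau>) < R" using bound[OF \<tau>] M by simp
        have "\<bar>F \<beta> \<tau> - S\<bar> \<le> real n * (M ^ (n - 1) * (D * (q ^ (N - n + 2) / (1 - q))))"
          unfolding F_def S_def q_def
          by (rule carleman_truncation_residual[where c = c and t = \<tau> and F = "f \<tau> (x \<tau>)",
                OF \<beta>n n(2) sums[OF \<tau> xR] decay[OF \<tau>] bound[OF \<tau>] M(2)])
        also have "M ^ (n - 1) = q ^ (n - 1) * R ^ (n - 1)"
          using R by (simp add: q_def power_divide)
        also have "real n * (q ^ (n - 1) * R ^ (n - 1) * (D * (q ^ (N - n + 2) / (1 - q)))) =
            real n * (D * R ^ (n - 1)) * ((q ^ (n - 1) * q ^ (N - n + 2)) / (1 - q))"
          by simp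
        also have "q ^ (n - 1) * q ^ (N - n + 2) = q ^ (N + 1)"
        proof -
          have "N + 1 = (n - 1) + (N - n + 2)" using n by simp
          then show ?thesis by (metis power_add)
        qed
        finally show "\<bar>F \<beta> \<tau> - S\<bar> \<le> real n * (a * R ^ n) * c0"
          by (simp add: aR c0_def)
      qed
      also have "\<dots> = R ^ n * (real n * a * ((\<Sum>l=n..N. v l) + c0))"
        by (simp add: sum_distrib_left algebra_simps)
      also have "(\<Sum>l=n..N. v l) = c0 * (s n * E \<tau> - 1) + (real N + 1 - real n) * (\<epsilon> * G \<tau>)"
        using n w_sum[OF n(2), of \<tau>] by (simp add: v_def sum.distrib of_nat_diff flip: sum_distrib_left)
      also have "real n * a * (c0 * (s n * E \<tau> - 1) + (real N + 1 - real n) * (\<epsilon> * G \<tau>) + c0) =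
          c0 * (a * real n * s n * E \<tau>) + \<epsilon> * ((a * (real n * (real N + 1 - real n))) * G \<tau>)"
        by (simp add: algebra_simps)
      also have "R ^ n * \<dots> < R ^ n * (c0 * (a * real n * s n * E \<tau>) + \<epsilon> * (K * G \<tau>))"
      proof -
        have "real n * (real N + 1 - real n) \<le> real N * real N"
          using n by (intro mult_mono) auto
        then have "a * (real n * (real N + 1 - real n)) < K"
          using mult_left_mono[of _ _ a] a by (simp add: K_def le_less_trans[OF _ less_add_one])
        then show ?thesis using R \<epsilon> by (simp add: G_def)
      qed
      finally show "\<bar>u' \<beta> \<tau>\<bar> < V' \<beta> \<tau>" by (simp add: V'_def n_def)
    qed
    then show ?thesis using \<alpha> by (simp add: V_def mi_of_degree_def)
  qed
  have "\<bar>u \<alpha> t\<bar> \<le> R ^ k * (c0 * w k t)"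
  proof (rule field_le_epsilon)
    fix \<delta> :: real assume "\<delta> > 0"
    then have "\<delta> / (R ^ k * G t) > 0" using R by (simp add: G_def)
    from strict[OF this] R show "\<bar>u \<alpha> t\<bar> \<le> R ^ k * (c0 * w k t) + \<delta>"
      by (simp add: G_def distrib_left)
  qed
  then show ?thesis
    using \<alpha> by (simp add: u_def mi_of_degree_def c0_def q_def w_def s_def E_def a_def)
qed

section \<open>The convergence rate\<close>

lemma power_div_fact_le_stirling:
  assumes "N \<ge> 1"
  shows "real N ^ (N - 1) / fact N \<le> exp 1 ^ N * real N powr (- 3 / 2) / sqrt (2 * pi)"
proof -
  have powr: "real N powr (- 3 / 2) = 1 / (real N * sqrt (real N))"
  proof -
    have "real N powr (- 3 / 2) = real N powr (- (1 + 1 / 2))" by simp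
    also have "\<dots> = 1 / (real N * sqrt (real N))"
      using assms by (simp only: powr_minus powr_add powr_half_sqrt powr_one of_nat_0_le_iff inverse_eq_divide)
    finally show ?thesis .
  qed
  have pow: "real N ^ N = real N * real N ^ (N - 1)" using assms by (cases N) auto
  have "sqrt (2 * pi) * sqrt (real N) * (real N ^ N / exp 1 ^ N) \<le> fact N"
    using stirling_lower_bound[OF assms] by (simp add: real_sqrt_mult power_divide)
  then have "sqrt (2 * pi) * sqrt (real N) * real N * real N ^ (N - 1) \<le> exp 1 ^ N * fact N"
    unfolding pow by (simp add: field_simps)
  then show ?thesis
    unfolding powr using assms by (simp add: divide_simps) (simp add: mult_ac)
qed

theorem theorem3p1:
  fixes f :: "real \<Rightarrow> real ^ 'd \<Rightarrow> real ^ 'd"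
    and c :: "'d \<Rightarrow> nat ^ 'd \<Rightarrow> real \<Rightarrow> real"
    and x :: "real \<Rightarrow> real ^ 'd"
    and y :: "nat \<Rightarrow> real \<Rightarrow> nat ^ 'd \<Rightarrow> real"
    and x0 :: "real ^ 'd"
    and t0 D0 R T M0 :: real
    and N :: nat
  assumes D0_pos: "D0 > 0" and R_pos: "R > 0"
    and maclaurin: "\<And>t z j. t \<ge> t0 \<Longrightarrow> infnorm z < R \<Longrightarrow>
          ((\<lambda>\<alpha>. c j \<alpha> t * monomial z \<alpha>) has_sum (f t z $ j)) (UNIV - {0})"
    and decay: "\<And>t k. t \<ge> t0 \<Longrightarrow> k \<ge> 1 \<Longrightarrow>
          (\<Sum>j\<in>UNIV. \<Sum>\<alpha>\<in>mi_of_degree k. \<bar>c j \<alpha> t\<bar>) \<le> D0 * R powi (- int k)"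
    and x0_pos: "0 < infnorm x0" and x0_less: "infnorm x0 < R / exp 1"
    and T_eq: "T = (exp 1 - 1) * R / ((2 * exp 1 - 1) * D0) * ln (R / (exp 1 * infnorm x0))"
    and M0_eq: "M0 = infnorm x0 powr ((exp 1 - 1) / (2 * exp 1 - 1))
                     * (R / exp 1) powr (exp 1 / (2 * exp 1 - 1))"
    and x_sol: "ode_solution f t0 x0 {t0..t0 + T} x"
    and N_ge: "N \<ge> 1"
    and y_sol: "finite_section_solution c t0 x0 {t0..t0 + T} N y"
  shows "M0 < R / exp 1 \<and>
    (\<forall>t\<in>{t0..t0 + T}.
       infnorm (first_block y t - x t) \<le>
         R * M0 / (sqrt (2 * pi) * (R - M0)) * real N powr (- 3 / 2)
         * exp (D0 * (t - t0) * real N / R)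
         * (infnorm x0 * exp 1 / R) powr ((exp 1 - 1) * real N / (2 * exp 1 - 1)))"
proof -
  define e :: real where "e = exp 1"
  define r0 where "r0 = infnorm x0"
  have e: "e > 1" by (simp add: e_def)
  have r0: "0 < r0" "r0 < R / e" using x0_pos x0_less by (auto simp: r0_def e_def)
  define p where "p = (e - 1) / (2 * e - 1)"
  have p: "0 < p" "e / (2 * e - 1) = 1 - p" using e by (auto simp: p_def field_simps)
  have M0: "M0 = r0 powr p * (R / e) powr (1 - p)"
    using M0_eq p(2) by (simp add: p_def e_def r0_def)
  \<comment> \<open>\<open>M0\<close> is a weighted geometric mean of \<open>r0\<close> and \<open>R / e\<close>; dividing by \<open>R / e\<close> shows both
      \<open>M0 < R / e\<close> and the base of the geometric rate.\<close>
  have M0_ratio: "M0 = R / e * (r0 * e / R) powr p"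
  proof -
    have "(r0 * e / R) powr p = (r0 / (R / e)) powr p" by simp
    also have "\<dots> = r0 powr p / (R / e) powr p"
      using r0 R_pos e by (intro powr_divide)
    finally show ?thesis
      using R_pos e unfolding M0 by (simp add: powr_diff)
  qed
  have ratio: "0 < r0 * e / R" "r0 * e / R < 1" using r0 e R_pos by (auto simp: field_simps)
  have "(r0 * e / R) powr p < 1" using powr_less_mono2[OF p(1), of "r0 * e / R" 1] ratio by simp
  then have M0_less: "M0 < R / e" unfolding M0_ratio using R_pos e by (simp add: divide_strict_right_mono)
  have "R / e < R" using R_pos e by (simp add: field_simps)
  have M0_pos: "M0 > 0" unfolding M0 using r0 R_pos e by simp
  have decay': "(\<Sum>\<gamma>\<in>mi_of_degree m. \<bar>c j \<gamma> t\<bar>) \<le> D0 / R ^ m" if "t \<ge> t0" "m \<ge> 1" for t j m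
  proof -
    have "(\<Sum>\<gamma>\<in>mi_of_degree m. \<bar>c j \<gamma> t\<bar>) \<le> (\<Sum>j\<in>UNIV. \<Sum>\<gamma>\<in>mi_of_degree m. \<bar>c j \<gamma> t\<bar>)"
      by (rule member_le_sum) (auto intro: sum_nonneg)
    also have "\<dots> \<le> D0 / R ^ m"
      using decay[OF that] by (simp add: power_int_minus divide_inverse)
    finally show ?thesis .
  qed
  have ode: "(x has_vector_derivative f t (x t)) (at t within {t0..t0 + T})"
    if "t \<in> {t0..t0 + T}" for t
    using x_sol that unfolding ode_solution_def by blast
  have x_init: "x t0 = x0" using x_sol by (simp add: ode_solution_def)
  \<comment> \<open>\<open>T\<close> is the time at which the exponential bound with \<open>\<rho> = R / e\<close> reaches \<open>M0\<close>.\<close>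
  have growth_T: "r0 * exp (D0 / (R - R / e) * T) = M0"
  proof -
    have "D0 / (R - R / e) * T = (1 - p) * ln (R / e / r0)"
      unfolding T_eq p(2)[symmetric] e_def[symmetric] r0_def[symmetric] using D0_pos R_pos e
      by (simp add: divide_simps) (simp add: algebra_simps)
    then have "exp (D0 / (R - R / e) * T) = (R / e / r0) powr (1 - p)"
      using r0 R_pos e by (simp add: powr_def)
    also have "\<dots> = (R / e) powr (1 - p) / r0 powr (1 - p)"
      using r0 R_pos e by (intro powr_divide)
    finally show ?thesis unfolding M0 using r0 by (simp add: powr_diff)
  qed
  have bounded: "infnorm (x t) \<le> M0" if t: "t \<in> {t0..t0 + T}" for t
  proof -
    have "infnorm (x t) \<le> infnorm (x t0) * exp (D0 / (R - R / e) * (t - t0))"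
    proof (rule solution_growth[where f = f and c = c and ?t1.0 = "t0 + T"])
      show "infnorm (x t0) * exp (D0 / (R - R / e) * (t0 + T - t0)) < R / e"
        using growth_T M0_less by (simp add: x_init r0_def)
    qed (use ode maclaurin decay' D0_pos x_init x0_pos t \<open>R / e < R\<close> in auto)
    also have "\<dots> \<le> r0 * exp (D0 / (R - R / e) * T)"
      unfolding x_init r0_def[symmetric] using t r0 D0_pos \<open>R / e < R\<close>
      by (auto intro!: mult_left_mono divide_right_mono)
    finally show ?thesis unfolding growth_T .
  qed
  have "infnorm (first_block y t - x t) \<le>
         R * M0 / (sqrt (2 * pi) * (R - M0)) * real N powr (- 3 / 2)
         * exp (D0 * (t - t0) * real N / R)
         * (infnorm x0 * exp 1 / R) powr ((exp 1 - 1) * real N / (2 * exp 1 - 1))"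
    if t: "t \<in> {t0..t0 + T}" for t
  proof (rule infnorm_le_cart)
    fix j :: 'd
    define q where "q = M0 / R"
    have q: "0 < q" "q < 1" using M0_pos M0_less R_pos \<open>R / e < R\<close> by (auto simp: q_def)
    define X where "X = exp (D0 / R * real N * (t - t0))"
    have "\<bar>(first_block y t - x t) $ j\<bar> = \<bar>y 1 t (axis j 1) - monomial (x t) (axis j 1)\<bar>"
      unfolding monomial_axis by (simp add: first_block_def)
    also have "\<dots> \<le> R ^ 1 * (q ^ (N + 1) / (1 - q) *
      (real 1 / real N * (real N ^ (N - 1) / fact (N - 1)) * X - (if 1 = N then 1 else 0)))"
      unfolding q_def X_def
    proof (rule carleman_error_bound[where f = f and c = c and ?t1.0 = "t0 + T"])
      show "axis j 1 \<in> mi_of_degree 1" unfolding mi_of_degree_def mem_Collect_eq by (rule mi_degree_axis)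
      show "M0 < R" using M0_less \<open>R / e < R\<close> by simp
    qed (use ode maclaurin decay' D0_pos x_init y_sol N_ge bounded M0_pos t in auto)
    also have "\<dots> \<le> R * (q ^ (N + 1) / (1 - q) * (real N ^ (N - 1) / fact N * X))"
    proof -
      have "fact N = real N * fact (N - 1)" using N_ge by (simp add: fact_reduce)
      then have "real 1 / real N * (real N ^ (N - 1) / fact (N - 1)) = real N ^ (N - 1) / fact N"
        by simp
      then show ?thesis
        using R_pos q by (simp only: power_one_right) (intro mult_left_mono, auto)
    qed
    also have "\<dots> \<le> R * (q ^ (N + 1) / (1 - q) * (e ^ N * real N powr (- 3 / 2) / sqrt (2 * pi) * X))"
      using R_pos q power_div_fact_le_stirling[OF N_ge]
      by (intro mult_left_mono mult_right_mono) (auto simp: X_def e_def)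
    also have "\<dots> = R * (q / (1 - q)) / sqrt (2 * pi) * real N powr (- 3 / 2) * X * (q * e) ^ N"
      by (simp add: power_mult_distrib)
    also have "R * (q / (1 - q)) / sqrt (2 * pi) = R * M0 / (sqrt (2 * pi) * (R - M0))"
      using R_pos q by (simp add: q_def field_simps)
    also have "X = exp (D0 * (t - t0) * real N / R)" by (simp add: X_def mult_ac)
    also have "(q * e) ^ N = (infnorm x0 * exp 1 / R) powr ((exp 1 - 1) * real N / (2 * exp 1 - 1))"
    proof -
      have "q * e = (r0 * e / R) powr p" unfolding q_def M0_ratio using R_pos e by simp
      moreover from this have "(r0 * e / R) powr p > 0"
        using q e by (metis less_trans mult_pos_pos zero_less_one)
      ultimately have "(q * e) ^ N = ((r0 * e / R) powr p) powr real N"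
        by (simp only: powr_realpow)
      also have "\<dots> = (r0 * e / R) powr (p * real N)" by (rule powr_powr)
      finally show ?thesis by (simp add: p_def e_def r0_def)
    qed
    finally show "\<bar>(first_block y t - x t) $ j\<bar> \<le>
         R * M0 / (sqrt (2 * pi) * (R - M0)) * real N powr (- 3 / 2)
         * exp (D0 * (t - t0) * real N / R)
         * (infnorm x0 * exp 1 / R) powr ((exp 1 - 1) * real N / (2 * exp 1 - 1))" .
  qed
  then show ?thesis using M0_less by (simp add: e_def)
qed

end
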